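(* Let $Z$ be a countable set, let $\lozenge$ be a $\mathbb{Q}$-bilinear, commutative, associative product on the vector space $\mathbb{Q}Z$ with basis $Z$, and let $\star$ be the associated generalised quasi-shuffle product on $\mathbb{Q}\langle Z\rangle$. Let $\Psi_{\tanh}:\mathbb{Q}\langle Z\rangle\to\mathbb{Q}\langle Z\rangle$ be the linear map with $\Psi_{\tanh}(1)=1$ and, for $w$ a word of length $n\ge 1$, $$\Psi_{\tanh}(w)=\sum_{(i_1,\ldots,i_l)\in\mathcal{C}(n)}c_{i_1}\cdots c_{i_l}\,(i_1,\ldots,i_l)[w],$$ where $c_j$ is the coefficient of $x^j$ in the Taylor expansion of $\tanh(x)$ at $0$. Then $\Psi_{\tanh}$ is an algebra isomorphism $$\Psi_{\tanh}:(\mathbb{Q}\langle Z\rangle,\sqcup\!\sqcup)\to(\mathbb{Q}\langle Z\rangle,\star),$$ where $\sqcup\!\sqcup$ denotes the shuffle product.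
   Context: $\mathbb{Q}\langle Z\rangle$ is the vector space of non-commutative polynomials in the letters $Z$, with basis the words (monomials) in $Z$, the empty word being $1$. The shuffle product $\sqcup\!\sqcup$ is the bilinear product with $w\mathbin{\sqcup\!\sqcup}1=1\mathbin{\sqcup\!\sqcup}w=w$ and $au\mathbin{\sqcup\!\sqcup}bv=a(u\mathbin{\sqcup\!\sqcup}bv)+b(au\mathbin{\sqcup\!\sqcup}v)$ for letters $a,b\in Z$ and words $u,v,w$. For $c\in\mathbb{Q}Z$, let $L_c:\mathbb{Q}\langle Z\rangle\to\mathbb{Q}\langle Z\rangle$ be the linear map with $L_c(1)=0$ and $L_c(xw)=(c\lozenge x)w$ for $x\in Z$ and $w$ a word. The generalised quasi-shuffle product $\star$ is the bilinear product defined recursively by $w\star 1=1\star w=w$ and $$au\star bv=a(u\star bv)+b(au\star v)-L_{a\lozenge b}(u\star v)$$ for letters $a,b\in Z$ and words $u,v,w$. (It is commutative and associative.) A composition of $n$ is a sequence $(i_1,\ldots,i_l)$ of positive integers with $i_1+\cdots+i_l=n$; $\mathcal{C}(n)$ is the set of compositions of $n$. For letters $a_1,\ldots,a_k\in Z$ put $[a_1\cdots a_k]:=a_1\lozenge\cdots\lozenge a_k\in\mathbb{Q}Z$. For a composition $I=(i_1,\ldots,i_l)$ of $n$ and a word $w=a_1\cdots a_n$, $$I[w]:=[a_1\cdots a_{i_1}]\,[a_{i_1+1}\cdots a_{i_1+i_2}]\cdots[a_{i_1+\cdots+i_{l-1}+1}\cdots a_n]$$ (concatenation product in $\mathbb{Q}\langle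 Z\rangle$). *)

theory Defs
  imports "HOL-Analysis.Analysis" "HOL-Library.Poly_Mapping"
begin

text \<open>
  The vector space with basis \<open>'a\<close> is the type \<open>'a \<Rightarrow>\<^sub>0 rat\<close>; the basis vector of \<open>x\<close> is
  \<open>Poly_Mapping.single x 1\<close>. With letters in \<open>'z\<close>, the span of the letters is \<open>'z \<Rightarrow>\<^sub>0 rat\<close> and
  the non-commutative polynomials are \<open>'z list \<Rightarrow>\<^sub>0 rat\<close>.
\<close>

type_synonym 'a qvec = "'a \<Rightarrow>\<^sub>0 rat"
type_synonym 'z ncpoly = "'z list \<Rightarrow>\<^sub>0 rat"

definition qscale :: "rat \<Rightarrow> 'a qvec \<Rightarrow> 'a qvec" where
  "qscale c p = Poly_Mapping.map ((*) c) p"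

lemma lookup_qscale [simp]:
  "Poly_Mapping.lookup (qscale c p) x = c * Poly_Mapping.lookup p x"
  by (simp add: qscale_def map.rep_eq when_def)

lemma vector_space_qscale: "vector_space qscale"
  by unfold_locales (auto intro!: poly_mapping_eqI simp: lookup_add algebra_simps)

abbreviation basis_vec :: "'a \<Rightarrow> 'a qvec" where
  "basis_vec x \<equiv> Poly_Mapping.single x 1"

abbreviation qlinear :: "('a qvec \<Rightarrow> 'b qvec) \<Rightarrow> bool" where
  "qlinear \<equiv> Vector_Spaces.linear qscale qscale"

definition qbilinear :: "('a qvec \<Rightarrow> 'b qvec \<Rightarrow> 'c qvec) \<Rightarrow> bool" where
  "qbilinear m \<longleftrightarrow> (\<forall>p. qlinear (m p)) \<and> (\<forall>q. qlinear (\<lambda>p. m p q))"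

definition lin_ext :: "('a \<Rightarrow> 'b qvec) \<Rightarrow> 'a qvec \<Rightarrow> 'b qvec" where
  "lin_ext f p = (\<Sum>x\<in>Poly_Mapping.keys p. qscale (Poly_Mapping.lookup p x) (f x))"

definition bilin_ext :: "('a \<Rightarrow> 'b \<Rightarrow> 'c qvec) \<Rightarrow> 'a qvec \<Rightarrow> 'b qvec \<Rightarrow> 'c qvec" where
  "bilin_ext f p q = lin_ext (\<lambda>x. lin_ext (f x) q) p"

lemma lin_ext_basis_vec [simp]: "lin_ext f (basis_vec x) = f x"
  by (auto intro!: poly_mapping_eqI simp: lin_ext_def)

lemma lin_ext_superset:
  assumes "finite S" "Poly_Mapping.keys p \<subseteq> S"
  shows "lin_ext f p = (\<Sum>x\<in>S. qscale (Poly_Mapping.lookup p x) (f x))"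
  unfolding lin_ext_def
  by (rule sum.mono_neutral_left)
    (use assms in \<open>auto intro!: poly_mapping_eqI simp: in_keys_iff\<close>)

lemma qlinear_lin_ext: "qlinear (lin_ext f)"
proof -
  interpret vector_space "qscale :: rat \<Rightarrow> 'b qvec \<Rightarrow> 'b qvec"
    by (rule vector_space_qscale)
  have add: "lin_ext f (p + q) = lin_ext f p + lin_ext f q" for p q
  proof -
    let ?S = "Poly_Mapping.keys p \<union> Poly_Mapping.keys q"
    have "Poly_Mapping.keys (p + q) \<subseteq> ?S"
      by (rule Poly_Mapping.keys_add)
    then show ?thesis
      by (simp add: lin_ext_superset[of ?S] lookup_add scale_left_distrib sum.distrib)
  qed
  have scale: "lin_ext f (qscale c p) = qscale c (lin_ext f p)" for c p
  proof -
    let ?S = "Poly_Mapping.keys p"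
    have "Poly_Mapping.keys (qscale c p) \<subseteq> ?S"
      by (auto simp: in_keys_iff)
    then show ?thesis
      by (simp add: lin_ext_superset[of ?S] scale_sum_right)
  qed
  show ?thesis
    unfolding Vector_Spaces.linear_iff
    by (intro conjI allI vector_space_qscale add scale)
qed

definition conc :: "'z ncpoly \<Rightarrow> 'z ncpoly \<Rightarrow> 'z ncpoly" where
  "conc = bilin_ext (\<lambda>u v. basis_vec (u @ v))"

definition letters :: "'z qvec \<Rightarrow> 'z ncpoly" where
  "letters = lin_ext (\<lambda>x. basis_vec [x])"

definition prepend :: "'z \<Rightarrow> 'z ncpoly \<Rightarrow> 'z ncpoly" where
  "prepend a = conc (basis_vec [a])"

fun shuffle_words :: "'z list \<Rightarrow> 'z list \<Rightarrow> 'z ncpoly" where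
  "shuffle_words [] w = basis_vec w"
| "shuffle_words w [] = basis_vec w"
| "shuffle_words (a # u) (b # v) =
     prepend a (shuffle_words u (b # v)) + prepend b (shuffle_words (a # u) v)"

definition shuffle_prod :: "'z ncpoly \<Rightarrow> 'z ncpoly \<Rightarrow> 'z ncpoly" where
  "shuffle_prod = bilin_ext shuffle_words"

definition L_map ::
    "('z qvec \<Rightarrow> 'z qvec \<Rightarrow> 'z qvec) \<Rightarrow> 'z qvec \<Rightarrow> 'z ncpoly \<Rightarrow> 'z ncpoly" where
  "L_map dia c = lin_ext (\<lambda>w. case w of
       [] \<Rightarrow> 0
     | x # v \<Rightarrow> conc (letters (dia c (basis_vec x))) (basis_vec v))"

fun star_words ::
    "('z qvec \<Rightarrow> 'z qvec \<Rightarrow> 'z qvec) \<Rightarrow> 'z list \<Rightarrow> 'z list \<Rightarrow> 'z ncpoly" where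
  "star_words dia [] w = basis_vec w"
| "star_words dia w [] = basis_vec w"
| "star_words dia (a # u) (b # v) =
     prepend a (star_words dia u (b # v)) + prepend b (star_words dia (a # u) v)
       - L_map dia (dia (basis_vec a) (basis_vec b)) (star_words dia u v)"

definition star_prod ::
    "('z qvec \<Rightarrow> 'z qvec \<Rightarrow> 'z qvec) \<Rightarrow> 'z ncpoly \<Rightarrow> 'z ncpoly \<Rightarrow> 'z ncpoly" where
  "star_prod dia = bilin_ext (star_words dia)"

definition algebra_iso ::
    "('a qvec \<Rightarrow> 'a qvec \<Rightarrow> 'a qvec) \<Rightarrow> 'a qvec \<Rightarrow>
     ('b qvec \<Rightarrow> 'b qvec \<Rightarrow> 'b qvec) \<Rightarrow> 'b qvec \<Rightarrow> ('a qvec \<Rightarrow> 'b qvec) \<Rightarrow> bool" where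
  "algebra_iso m e m' e' f \<longleftrightarrow>
     qlinear f \<and> bij f \<and> f e = e' \<and> (\<forall>p q. f (m p q) = m' (f p) (f q))"

definition compositions :: "nat \<Rightarrow> nat list set" where
  "compositions n = {I. (\<forall>i\<in>set I. 0 < i) \<and> sum_list I = n}"

lemma finite_compositions: "finite (compositions n)"
proof (rule finite_subset)
  have "length I \<le> sum_list I" if "\<forall>i\<in>set I. 0 < i" for I :: "nat list"
    using that by (induction I) auto
  then show "compositions n \<subseteq> {I. set I \<subseteq> {..n} \<and> length I \<le> n}"
    using member_le_sum_list by (fastforce simp: compositions_def)
qed (rule finite_lists_length_le, simp)

text \<open>
  \<open>bracket dia [a\<^sub>1, \<dots>, a\<^sub>k]\<close> is the product of the letters under \<open>dia\<close>. The value on the empty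
  word is a dummy: \<open>comp_act\<close> applies \<open>bracket\<close> to non-empty blocks only, whenever its first
  argument is a composition of the length of its second.
\<close>

fun bracket :: "('z qvec \<Rightarrow> 'z qvec \<Rightarrow> 'z qvec) \<Rightarrow> 'z list \<Rightarrow> 'z qvec" where
  "bracket dia [] = 0"
| "bracket dia [a] = basis_vec a"
| "bracket dia (a # b # w) = dia (basis_vec a) (bracket dia (b # w))"

fun comp_act ::
    "('z qvec \<Rightarrow> 'z qvec \<Rightarrow> 'z qvec) \<Rightarrow> nat list \<Rightarrow> 'z list \<Rightarrow> 'z ncpoly" where
  "comp_act dia [] w = basis_vec []"
| "comp_act dia (i # I) w =
     conc (letters (bracket dia (take i w))) (comp_act dia I (drop i w))"

text \<open>
  The Taylor coefficients of \<open>tanh\<close> at \<open>0\<close>, as rational numbers. The lemma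
  \<open>of_rat_tanh_coeff\<close> shows that the description is proper.
\<close>

definition tanh_coeff :: "nat \<Rightarrow> rat" where
  "tanh_coeff j = (THE q. real_of_rat q = (deriv ^^ j) (tanh :: real \<Rightarrow> real) 0 / fact j)"

lemma higher_deriv_tanh:
  "\<exists>p. (\<forall>i. coeff p i \<in> \<rat>) \<and> (deriv ^^ j) (tanh :: real \<Rightarrow> real) = (\<lambda>x. poly p (tanh x))"
proof (induction j)
  case 0
  show ?case
    by (rule exI[of _ "[:0, 1:]"]) (auto simp: coeff_pCons split: nat.split)
next
  case (Suc j)
  then obtain p where p: "\<And>i. coeff p i \<in> \<rat>"
    and eq: "(deriv ^^ j) (tanh :: real \<Rightarrow> real) = (\<lambda>x. poly p (tanh x))"
    by blast
  let ?q = "pderiv p * [:1, 0, -1:]"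
  have "deriv (\<lambda>x. poly p (tanh x)) x = poly ?q (tanh x)" for x :: real
    by (rule DERIV_imp_deriv, rule DERIV_chain2[OF poly_DERIV, THEN DERIV_cong])
      (auto intro!: derivative_eq_intros simp: power2_eq_square algebra_simps)
  moreover have "coeff ?q i \<in> \<rat>" for i
    unfolding coeff_mult
    by (intro Rats_sum Rats_mult)
      (auto simp: coeff_pderiv coeff_pCons p split: nat.split simp del: of_nat_Suc
        intro!: Rats_mult)
  ultimately show ?case
    by (intro exI[of _ ?q]) (auto simp: eq)
qed

lemma of_rat_tanh_coeff:
  "real_of_rat (tanh_coeff j) = (deriv ^^ j) (tanh :: real \<Rightarrow> real) 0 / fact j"
proof -
  obtain p where p: "\<And>i. coeff p i \<in> \<rat>"
    and eq: "(deriv ^^ j) (tanh :: real \<Rightarrow> real) = (\<lambda>x. poly p (tanh x))"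
    using higher_deriv_tanh by blast
  have "(deriv ^^ j) (tanh :: real \<Rightarrow> real) 0 / fact j = coeff p 0 / of_nat (fact j)"
    by (simp add: eq poly_0_coeff_0)
  also have "\<dots> \<in> \<rat>"
    by (intro Rats_divide p Rats_of_nat)
  finally obtain q where q: "(deriv ^^ j) (tanh :: real \<Rightarrow> real) 0 / fact j = real_of_rat q"
    by (auto simp: Rats_def)
  then have "tanh_coeff j = q"
    unfolding tanh_coeff_def by (intro the_equality) auto
  with q show ?thesis by simp
qed

definition Psi_tanh ::
    "('z qvec \<Rightarrow> 'z qvec \<Rightarrow> 'z qvec) \<Rightarrow> 'z ncpoly \<Rightarrow> 'z ncpoly" where
  "Psi_tanh dia = lin_ext (\<lambda>w. if w = [] then basis_vec [] else
     (\<Sum>I\<in>compositions (length w). qscale (prod_list (map tanh_coeff I)) (comp_act dia I w)))"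

end

theory Submission
  imports Defs
begin

text \<open>
  Write \<open>t = tanh\<close>, \<open>c\<^sub>j\<close> for its Taylor coefficients, \<open>sh\<close> for the shuffle product and \<open>\<Psi>\<close> for the
  map in question. What makes \<open>\<Psi>\<close> multiplicative is the addition formula in the form
  \<open>t(x + y) = t(x) + t(y) - t(x) t(y) t(x + y)\<close>: its three terms are matched by the three terms of
  the recursion for the product \<open>\<star>\<close>.

  Splitting off the first block of a composition gives \<open>\<Psi>(w) = \<Sum> c\<^sub>i [w\<^sub>1 \<dots> w\<^sub>i] \<Psi>(w\<^sub>i\<^sub>+\<^sub>1 \<dots>)\<close> for a
  non-empty word \<open>w\<close>. Cutting a word into a prefix and a suffix is compatible with shuffling: a cut
  of a shuffle of \<open>u\<close> and \<open>v\<close> is a cut of \<open>u\<close>, a cut of \<open>v\<close>, a shuffle of the prefixes and a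
  shuffle of the suffixes. As \<open>\<diamond>\<close> is commutative and associative, every shuffle of the prefixes has
  the same bracket, so only their number, a binomial coefficient, counts. Hence
  \<open>\<Psi>(u sh v) = \<Sum>\<^sub>i\<^sub>,\<^sub>j A(i,j) [u\<^sub>1 \<dots> u\<^sub>i v\<^sub>1 \<dots> v\<^sub>j] X(i,j)\<close> for \<open>u\<close>, \<open>v\<close> not both empty
  (\<open>Psi_tanh_shuffle_expansion\<close>), where \<open>X(i,j)\<close> is \<open>\<Psi>\<close> of the shuffle of the two suffixes and
  \<open>A(i,j)\<close> is the binomial coefficient times \<open>c\<^sub>i\<^sub>+\<^sub>j\<close>, that is, the coefficient of \<open>x\<^sup>i y\<^sup>j\<close> in
  \<open>t(x + y)\<close>.

  By induction on the total length, \<open>X(i,j)\<close> is the \<open>\<star>\<close>-product of the two images, except for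
  \<open>i = j = 0\<close>. Multiplying the expansions of \<open>\<Psi>(u)\<close> and \<open>\<Psi>(v)\<close> with the recursion for \<open>\<star>\<close> produces
  the terms \<open>c\<^sub>i [u\<^sub>1 \<dots> u\<^sub>i] X(i,0)\<close>, the terms \<open>c\<^sub>j [v\<^sub>1 \<dots> v\<^sub>j] X(0,j)\<close> and, with a minus sign,
  \<open>c\<^sub>i c\<^sub>j L(X(i,j))\<close>, where \<open>L\<close> multiplies the first letter of a word by the bracket of
  \<open>u\<^sub>1 \<dots> u\<^sub>i v\<^sub>1 \<dots> v\<^sub>j\<close>. Expanding \<open>X(i,j)\<close> once more, \<open>L\<close> merges this bracket with the leading one,
  and the coefficient of \<open>[u\<^sub>1 \<dots> u\<^sub>r v\<^sub>1 \<dots> v\<^sub>s] X(r,s)\<close> in the total is the right-hand side of the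
  addition formula (\<open>tanh_add_coeff\<close>).

  Bijectivity holds because \<open>c\<^sub>1 = 1\<close>: the composition into ones contributes the word itself, every
  other composition only shorter words, so \<open>\<Psi>\<close> is unitriangular with respect to word length.
\<close>

section \<open>The addition formula for the coefficients of tanh\<close>

lemma higher_deriv_eq_fps_nth:
  fixes f :: "real \<Rightarrow> real"
  assumes "f has_fps_expansion F"
  shows "(deriv ^^ n) f 0 / fact n = fps_nth F n"
  using assms
proof (induction n arbitrary: f F)
  case 0
  then show ?case
    by (auto simp: has_fps_expansion_def eval_fps_at_0 dest: eventually_nhds_x_imp_x)
next
  case (Suc n)
  have "(deriv ^^ n) (deriv f) 0 / fact n = fps_nth (fps_deriv F) n"
    by (intro Suc.IH has_fps_expansion_deriv Suc.prems)
  then show ?case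
    by (simp add: funpow_Suc_right field_simps del: funpow.simps of_nat_Suc)
qed

lemma has_fps_expansion_unique_real:
  fixes f :: "real \<Rightarrow> real"
  assumes "f has_fps_expansion F" "f has_fps_expansion G"
  shows "F = G"
  using higher_deriv_eq_fps_nth[OF assms(1)] higher_deriv_eq_fps_nth[OF assms(2)]
  by (simp add: fps_eq_iff)

definition tanh_fps :: "rat fps" where
  "tanh_fps = Abs_fps tanh_coeff"

text \<open>
  The coefficients are rational by description, but \<open>tanh' = 1 - tanh\<^sup>2\<close> is known for the real
  function; comparing real Taylor series transports it to the rational series.
\<close>

lemma tanh_fps_ode: "fps_deriv tanh_fps = 1 - tanh_fps * tanh_fps"
proof -
  define S :: "real fps" where "S = (fps_exp 1 - fps_exp (-1)) / (fps_exp 1 + fps_exp (-1))"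
  have "(\<lambda>x::real. (exp x - exp (- x)) / (exp x + exp (- x))) has_fps_expansion S"
    unfolding S_def
    by (intro has_fps_expansion_divide' has_fps_expansion_diff has_fps_expansion_add
        has_fps_expansion_exp1 has_fps_expansion_exp_neg1) auto
  moreover have "(exp x - exp (- x)) / (exp x + exp (- x)) = tanh x" for x :: real
    by (simp add: tanh_altdef)
  ultimately have S: "(tanh :: real \<Rightarrow> real) has_fps_expansion S"
    by simp
  have "deriv (tanh :: real \<Rightarrow> real) = (\<lambda>x. 1 - tanh x * tanh x)"
    by (rule ext, rule DERIV_imp_deriv)
      (auto intro!: derivative_eq_intros simp: power2_eq_square)
  moreover have "(\<lambda>x::real. 1 - tanh x * tanh x) has_fps_expansion 1 - S * S"
    by (intro has_fps_expansion_diff has_fps_expansion_mult has_fps_expansion_1 S)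
  ultimately have "fps_deriv S = 1 - S * S"
    using has_fps_expansion_unique_real has_fps_expansion_deriv[OF S] by metis
  moreover have "fps_nth S j = of_rat (tanh_coeff j)" for j
    using higher_deriv_eq_fps_nth[OF S] by (simp add: of_rat_tanh_coeff)
  ultimately have "real_of_rat (fps_nth (fps_deriv tanh_fps) n)
      = real_of_rat (fps_nth (1 - tanh_fps * tanh_fps) n)" for n
    unfolding fps_eq_iff tanh_fps_def
    by (simp add: of_rat_mult of_rat_diff of_rat_add fps_mult_nth of_rat_sum)
  then show ?thesis
    by (simp add: fps_eq_iff)
qed

lemma tanh_coeff_0 [simp]: "tanh_coeff 0 = 0"
proof -
  have "real_of_rat (tanh_coeff 0) = 0"
    by (simp add: of_rat_tanh_coeff)
  then show ?thesis by simp
qed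

lemma tanh_coeff_1: "tanh_coeff (Suc 0) = 1"
  using arg_cong[OF tanh_fps_ode, of "\<lambda>F. fps_nth F 0"]
  by (simp add: tanh_fps_def)

text \<open>
  A series in two variables is a series in \<open>x\<close> whose coefficients are series in \<open>y\<close>. Then
  \<open>fps_deriv\<close> is the derivative in \<open>x\<close>, and this is the derivative in \<open>y\<close>.
\<close>

definition coeff_deriv :: "'a::comm_ring_1 fps fps \<Rightarrow> 'a fps fps" where
  "coeff_deriv F = Abs_fps (\<lambda>m. fps_deriv (fps_nth F m))"

lemma coeff_deriv_add: "coeff_deriv (F + G) = coeff_deriv F + coeff_deriv G"
  and coeff_deriv_diff: "coeff_deriv (F - G) = coeff_deriv F - coeff_deriv G"
  by (simp_all add: coeff_deriv_def fps_eq_iff algebra_simps)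

lemma coeff_deriv_mult: "coeff_deriv (F * G) = coeff_deriv F * G + F * coeff_deriv G"
proof (rule fps_ext)
  fix n
  show "fps_nth (coeff_deriv (F * G)) n = fps_nth (coeff_deriv F * G + F * coeff_deriv G) n"
    by (simp add: coeff_deriv_def fps_mult_nth fps_deriv_sum sum.distrib add.commute)
qed

text \<open>
  Uniqueness for the transport equation \<open>\<partial>G/\<partial>x - \<partial>G/\<partial>y = H G\<close> with initial value \<open>0\<close> at \<open>x = 0\<close>:
  the equation determines each coefficient of \<open>G\<close> in \<open>x\<close> from the earlier ones.
\<close>

lemma bivariate_transport_eq_0:
  fixes G H :: "'a::field_char_0 fps fps"
  assumes "fps_deriv G - coeff_deriv G = H * G"
    and "fps_nth G 0 = 0"
  shows "G = 0"
proof -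
  have "fps_nth G m = 0" for m
  proof (induction m rule: less_induct)
    case (less m)
    show ?case
    proof (cases m)
      case 0
      with assms(2) show ?thesis by simp
    next
      case (Suc k)
      have "fps_nth (fps_deriv G) k = fps_nth (coeff_deriv G) k + fps_nth (H * G) k"
        using assms(1) by (metis diff_add_cancel add.commute fps_add_nth)
      moreover have "fps_nth (coeff_deriv G) k = 0" "fps_nth (H * G) k = 0"
        using less Suc by (auto simp: coeff_deriv_def fps_mult_nth intro!: sum.neutral)
      ultimately have "of_nat (Suc k) * fps_nth G (Suc k) = 0"
        by simp
      then show ?thesis
        using Suc by (simp del: of_nat_Suc)
    qed
  qed
  then show ?thesis
    by (simp add: fps_eq_iff)
qed

text \<open>
  The coefficient of \<open>x\<^sup>m y\<^sup>n\<close> in the Taylor expansion of \<open>tanh (x + y)\<close>.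
\<close>

definition tanh_add_coeff :: "nat \<Rightarrow> nat \<Rightarrow> rat" where
  "tanh_add_coeff m n = of_nat ((m + n) choose m) * tanh_coeff (m + n)"

text \<open>
  Here \<open>X\<close>, \<open>Y\<close> and \<open>F\<close> are the expansions of \<open>tanh x\<close>, \<open>tanh y\<close> and \<open>tanh (x + y)\<close>. The operator
  \<open>\<partial>/\<partial>x - \<partial>/\<partial>y\<close> kills \<open>F\<close>, and with \<open>tanh' = 1 - tanh\<^sup>2\<close> it multiplies the defect \<open>G\<close> of the
  formula by \<open>Y - X\<close>; since \<open>G\<close> vanishes at \<open>x = 0\<close>, it vanishes identically.
\<close>

lemma tanh_addition_fps:
  fixes F :: "rat fps fps"
  defines "X \<equiv> Abs_fps (\<lambda>m. fps_const (tanh_coeff m))"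
    and "Y \<equiv> fps_const tanh_fps"
    and "F \<equiv> Abs_fps (\<lambda>m. Abs_fps (tanh_add_coeff m))"
  shows "F = X + Y - X * (Y * F)"
proof -
  define G where "G = F + X * (Y * F) - X - Y"
  have dX: "fps_deriv X = 1 - X * X"
  proof (rule fps_ext)
    fix m
    have "fps_nth (fps_deriv X) m = fps_const (fps_nth (fps_deriv tanh_fps) m)"
      by (simp add: X_def tanh_fps_def fps_of_nat[symmetric] flip: fps_const_mult)
    also have "\<dots> = fps_nth (1 - X * X) m"
      by (simp add: tanh_fps_ode)
        (simp add: X_def tanh_fps_def fps_mult_nth fps_eq_iff fps_sum_nth)
    finally show "fps_nth (fps_deriv X) m = fps_nth (1 - X * X) m" .
  qed
  have cX: "coeff_deriv X = 0"
    by (simp add: X_def coeff_deriv_def fps_eq_iff)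
  have dY: "fps_deriv Y = 0"
    by (simp add: Y_def)
  have cY: "coeff_deriv Y = 1 - Y * Y"
    by (rule fps_ext) (auto simp: coeff_deriv_def Y_def tanh_fps_ode)
  have dF: "fps_deriv F = coeff_deriv F"
  proof -
    have "Suc m * ((Suc m + n) choose Suc m) = Suc n * ((m + Suc n) choose m)" for m n
      using Suc_times_binomial_eq[of "m + n" m] binomial_absorb_comp[of "Suc (m + n)" m]
      by (simp add: mult.commute Suc_diff_le del: binomial_Suc_Suc mult_Suc mult_Suc_right)
    then have "rat_of_nat (Suc m) * of_nat ((Suc m + n) choose Suc m)
        = of_nat (Suc n) * of_nat ((m + Suc n) choose m)" for m n
      by (metis of_nat_mult)
    then show ?thesis
      by (simp add: F_def tanh_add_coeff_def coeff_deriv_def fps_eq_iff fps_of_nat[symmetric]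
          mult.assoc[symmetric] del: of_nat_Suc binomial_Suc_Suc)
  qed
  have "fps_deriv G - coeff_deriv G = (Y - X) * G"
    unfolding G_def coeff_deriv_add coeff_deriv_diff coeff_deriv_mult
    by (simp add: dX cX dY cY dF algebra_simps)
  moreover have "fps_nth G 0 = 0"
    by (simp add: G_def X_def Y_def F_def tanh_add_coeff_def fps_eq_iff tanh_fps_def)
  ultimately have "G = 0"
    by (rule bivariate_transport_eq_0)
  then show ?thesis
    by (simp add: G_def algebra_simps)
qed

lemma tanh_add_coeff:
  "tanh_add_coeff m n =
     (if n = 0 then tanh_coeff m else 0) + (if m = 0 then tanh_coeff n else 0)
     - (\<Sum>i\<le>m. \<Sum>j\<le>n. tanh_coeff i * tanh_coeff j * tanh_add_coeff (m - i) (n - j))"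
  using arg_cong[OF tanh_addition_fps, of "\<lambda>F. fps_nth (fps_nth F m) n"]
  by (simp add: fps_mult_nth[of "Abs_fps _"] fps_sum_nth fps_mult_nth[of tanh_fps] sum_distrib_left
      mult.assoc atLeast0AtMost)
     (simp add: tanh_fps_def if_distribR add.commute)

section \<open>Linear maps, letters and the quasi-shuffle product\<close>

lemma qscale_add_right: "qscale c (p + q) = qscale c p + qscale c q"
  and qscale_diff_right: "qscale c (p - q) = qscale c p - qscale c q"
  and qscale_add_left: "qscale (c + d) p = qscale c p + qscale d p"
  and qscale_diff_left: "qscale (c - d) p = qscale c p - qscale d p"
  and qscale_qscale: "qscale c (qscale d p) = qscale (c * d) p"
  and qscale_one: "qscale 1 p = p"
  and qscale_zero_left: "qscale 0 p = 0"
  and qscale_zero_right: "qscale c 0 = 0"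
  and qscale_sum_right: "qscale c (\<Sum>x\<in>A. f x) = (\<Sum>x\<in>A. qscale c (f x))"
  and qscale_sum_left: "qscale (\<Sum>x\<in>A. g x) p = (\<Sum>x\<in>A. qscale (g x) p)"
  by (auto intro!: poly_mapping_eqI
      simp: lookup_add lookup_minus lookup_sum algebra_simps sum_distrib_left sum_distrib_right)

lemmas qscale_simps = qscale_add_right qscale_diff_right qscale_qscale qscale_one
  qscale_zero_left qscale_zero_right

lemma
  assumes "qlinear f"
  shows qlinear_add: "f (p + q) = f p + f q"
    and qlinear_scale: "f (qscale c p) = qscale c (f p)"
    and qlinear_diff: "f (p - q) = f p - f q"
    and qlinear_zero: "f 0 = 0"
    and qlinear_sum: "f (\<Sum>x\<in>A. g x) = (\<Sum>x\<in>A. f (g x))"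
proof -
  interpret Vector_Spaces.linear qscale qscale f by fact
  show "f (p + q) = f p + f q" "f (qscale c p) = qscale c (f p)" "f (p - q) = f p - f q"
    "f 0 = 0" "f (\<Sum>x\<in>A. g x) = (\<Sum>x\<in>A. f (g x))"
    by (rule add scale diff zero sum)+
qed

lemmas qlinear_simps = qlinear_add qlinear_scale qlinear_diff qlinear_zero

lemma qlinearI:
  assumes "\<And>p q. f (p + q) = f p + f q" and "\<And>c p. f (qscale c p) = qscale c (f p)"
  shows "qlinear f"
  using assms by (simp add: Vector_Spaces.linear_iff vector_space_qscale)

lemma lin_ext_basis_vec_eq: "lin_ext basis_vec p = p"
  by (rule poly_mapping_eqI)
    (simp add: lin_ext_def lookup_sum lookup_single when_def in_keys_iff if_distrib sum.delta
      cong: if_cong)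

text \<open>
  Multilinear identities are proved by applying this rule to one argument after the other, which
  reduces them to basis vectors.
\<close>

lemma qvec_induct [case_names basis zero add scale]:
  assumes "\<And>x. P (basis_vec x)" "P 0" "\<And>p q. P p \<Longrightarrow> P q \<Longrightarrow> P (p + q)"
    "\<And>c p. P p \<Longrightarrow> P (qscale c p)"
  shows "P p"
proof -
  have "P (\<Sum>x\<in>A. qscale (Poly_Mapping.lookup p x) (basis_vec x))" for A
    by (induction A rule: infinite_finite_induct) (auto intro: assms)
  then show ?thesis
    using lin_ext_basis_vec_eq[of p] by (metis lin_ext_def)
qed

lemma
  assumes "qbilinear m"
  shows qbilinear_left: "qlinear (\<lambda>p. m p q)" and qbilinear_right: "qlinear (m p)"
  using assms by (auto simp: qbilinear_def)

lemma qbilinear_simps: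
  assumes "qbilinear m"
  shows "m (p + p') q = m p q + m p' q" "m (qscale c p) q = qscale c (m p q)"
    "m (p - p') q = m p q - m p' q" "m 0 q = 0"
    "m p (q + q') = m p q + m p q'" "m p (qscale c q) = qscale c (m p q)"
    "m p (q - q') = m p q - m p q'" "m p 0 = 0"
  using qlinear_simps[OF qbilinear_left[OF assms]] qlinear_simps[OF qbilinear_right[OF assms]]
  by auto

lemma qbilinear_sum:
  assumes "qbilinear m"
  shows "m (\<Sum>x\<in>A. f x) q = (\<Sum>x\<in>A. m (f x) q)"
    "m p (\<Sum>y\<in>C. g y) = (\<Sum>y\<in>C. m p (g y))"
  using qlinear_sum[OF qbilinear_left[OF assms]] qlinear_sum[OF qbilinear_right[OF assms]]
  by auto

lemma qbilinearI:
  assumes "\<And>p p' q. m (p + p') q = m p q + m p' q"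
    "\<And>c p q. m (qscale c p) q = qscale c (m p q)"
    "\<And>p q q'. m p (q + q') = m p q + m p q'" "\<And>c p q. m p (qscale c q) = qscale c (m p q)"
  shows "qbilinear m"
  unfolding qbilinear_def by (intro conjI allI qlinearI assms)

lemma qbilinear_bilin_ext: "qbilinear (bilin_ext f)"
proof (rule qbilinearI)
  note lin = qlinear_simps[OF qlinear_lin_ext]
  fix p p' q q' c
  show "bilin_ext f (p + p') q = bilin_ext f p q + bilin_ext f p' q"
    "bilin_ext f (qscale c p) q = qscale c (bilin_ext f p q)"
    by (simp_all add: bilin_ext_def lin)
  show "bilin_ext f p (q + q') = bilin_ext f p q + bilin_ext f p q'"
    by (simp add: bilin_ext_def lin) (simp add: lin_ext_def qscale_simps sum.distrib)
  show "bilin_ext f p (qscale c q) = qscale c (bilin_ext f p q)"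
    by (simp add: bilin_ext_def lin)
      (simp add: lin_ext_def qscale_simps qscale_sum_right mult.left_commute)
qed

lemma bilin_ext_basis_vec: "bilin_ext f (basis_vec x) (basis_vec y) = f x y"
  by (simp add: bilin_ext_def)

text \<open>
  Concatenation with a linear combination of letters on the left; it carries the brackets, which
  are not single letters.
\<close>

definition lcons :: "'z qvec \<Rightarrow> 'z ncpoly \<Rightarrow> 'z ncpoly" where
  "lcons c P = conc (letters c) P"

lemma qbilinear_lcons: "qbilinear lcons"
  by (rule qbilinearI)
    (simp_all add: lcons_def conc_def letters_def qlinear_simps[OF qlinear_lin_ext]
      qbilinear_simps[OF qbilinear_bilin_ext])

lemma lcons_basis_vec: "lcons (basis_vec a) (basis_vec w) = basis_vec (a # w)"
  by (simp add: lcons_def conc_def letters_def bilin_ext_basis_vec)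

lemma prepend_eq_lcons: "prepend a P = lcons (basis_vec a) P"
  by (simp add: prepend_def lcons_def letters_def)

lemma qbilinear_star_prod: "qbilinear (star_prod dia)"
  by (simp add: star_prod_def qbilinear_bilin_ext)

lemma star_prod_one [simp]:
  "star_prod dia (basis_vec []) P = P" "star_prod dia P (basis_vec []) = P"
proof -
  note lin = qbilinear_simps[OF qbilinear_star_prod]
  have right: "star_words dia w [] = basis_vec w" for w
    by (cases w) auto
  show "star_prod dia (basis_vec []) P = P"
    by (induction P rule: qvec_induct) (simp_all add: lin, simp add: star_prod_def bilin_ext_basis_vec)
  show "star_prod dia P (basis_vec []) = P"
    by (induction P rule: qvec_induct)
       (simp_all add: lin, simp add: star_prod_def bilin_ext_basis_vec right)
qed

lemma qlinear_L_map: "qlinear (L_map dia c)"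
  by (simp add: L_map_def qlinear_lin_ext)

lemma L_map_one [simp]: "L_map dia c (basis_vec []) = 0"
  by (simp add: L_map_def)

lemma L_map_Cons: "L_map dia c (basis_vec (x # w)) = lcons (dia c (basis_vec x)) (basis_vec w)"
  by (simp add: L_map_def lcons_def)

lemma L_map_lcons:
  assumes "qbilinear dia"
  shows "L_map dia c (lcons d P) = lcons (dia c d) P"
proof -
  note lin = qlinear_simps[OF qlinear_L_map] qbilinear_simps[OF qbilinear_lcons]
    qbilinear_simps[OF assms]
  show ?thesis
  proof (induction d rule: qvec_induct)
    case (basis a)
    show ?case
      by (induction P rule: qvec_induct)
         (simp_all add: lin, simp add: lcons_basis_vec L_map_Cons)
  qed (simp_all add: lin)
qed

lemma L_map_left:
  assumes "qbilinear dia"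
  shows "L_map dia (c + d) P = L_map dia c P + L_map dia d P" (is ?add)
    and "L_map dia (qscale r c) P = qscale r (L_map dia c P)" (is ?scale)
    and "L_map dia 0 P = 0" (is ?zero)
proof -
  note lin = qlinear_simps[OF qlinear_L_map] qbilinear_simps[OF qbilinear_lcons]
    qbilinear_simps[OF assms]
  have word: "L_map dia b (basis_vec w)
      = (case w of [] \<Rightarrow> 0 | x # v \<Rightarrow> lcons (dia b (basis_vec x)) (basis_vec v))" for b w
    by (simp add: L_map_Cons split: list.split)
  show ?add ?scale ?zero
    by (induction P rule: qvec_induct;
        simp add: lin word qscale_simps algebra_simps split: list.split)+
qed

text \<open>
  The recursion that defines \<open>\<star>\<close> on words is linear in each of the four entries \<open>c\<close>, \<open>P\<close>, \<open>d\<close>, \<open>Q\<close>,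
  so it extends from letters and words to arbitrary vectors.
\<close>

lemma star_prod_lcons:
  assumes "qbilinear dia"
  shows "star_prod dia (lcons c P) (lcons d Q) =
    lcons c (star_prod dia P (lcons d Q)) + lcons d (star_prod dia (lcons c P) Q)
      - L_map dia (dia c d) (star_prod dia P Q)"
proof -
  note lin = qbilinear_simps[OF qbilinear_lcons] qbilinear_simps[OF qbilinear_star_prod]
    qlinear_simps[OF qlinear_L_map] L_map_left[OF assms] qbilinear_simps[OF assms]
    qscale_simps
  show ?thesis
  proof (induction c rule: qvec_induct)
    case (basis a)
    show ?case
    proof (induction d rule: qvec_induct)
      case (basis b)
      show ?case
      proof (induction P rule: qvec_induct)
        case (basis u)
        show ?case
          by (induction Q rule: qvec_induct)
             (simp_all add: lin, simp_all add: lcons_basis_vec star_prod_def bilin_ext_basis_vec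
               prepend_eq_lcons)
      qed (simp_all add: lin)
    qed (simp_all add: lin)
  qed (simp_all add: lin)
qed

section \<open>Deconcatenating a shuffle product\<close>

text \<open>
  The composite of the deconcatenation coproduct with a map \<open>B\<close> of prefix and suffix. The
  prefix stays a word, because its letters are collected one at a time.
\<close>

definition deconcat_sum :: "('z list \<Rightarrow> 'z ncpoly \<Rightarrow> 'b qvec) \<Rightarrow> 'z list \<Rightarrow> 'b qvec" where
  "deconcat_sum B w = (\<Sum>i\<le>length w. B (take i w) (basis_vec (drop i w)))"

lemma deconcat_sum_Cons:
  "deconcat_sum B (a # w) = B [] (basis_vec (a # w)) + deconcat_sum (\<lambda>x. B (a # x)) w"
  by (simp add: deconcat_sum_def sum.atMost_Suc_shift del: sum.atMost_Suc)

lemma deconcat_sum_prepend: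
  assumes "\<And>x. qlinear (B x)"
  shows "lin_ext (deconcat_sum B) (prepend a P) =
    B [] (prepend a P) + lin_ext (deconcat_sum (\<lambda>x. B (a # x))) P"
  by (induction P rule: qvec_induct)
    (simp_all add: prepend_eq_lcons qbilinear_simps[OF qbilinear_lcons] qscale_simps
      qlinear_simps[OF qlinear_lin_ext] qlinear_simps[OF assms] lcons_basis_vec deconcat_sum_Cons)

text \<open>
  Pascal's rule for the lattice paths behind a shuffle: the last two sums collect the paths by their
  first step.
\<close>

lemma pascal_double_sum:
  fixes T :: "nat \<Rightarrow> nat \<Rightarrow> 'b qvec"
  shows "(\<Sum>i\<le>Suc m. \<Sum>j\<le>Suc n. qscale (of_nat ((i + j) choose i)) (T i j)) = T 0 0
    + (\<Sum>i\<le>m. \<Sum>j\<le>Suc n. qscale (of_nat ((i + j) choose i)) (T (Suc i) j))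
    + (\<Sum>i\<le>Suc m. \<Sum>j\<le>n. qscale (of_nat ((i + j) choose i)) (T i (Suc j)))"
  unfolding sum.atMost_Suc_shift
  by (simp add: qscale_one qscale_add_left sum.distrib algebra_simps)

lemma shuffle_words_Nil2: "shuffle_words w [] = basis_vec w"
  by (cases w) auto

text \<open>
  Deconcatenation is a homomorphism for the shuffle product. If \<open>B\<close> does not depend on the order of
  the letters in the prefix, all shuffles of the prefixes \<open>take i u\<close> and \<open>take j v\<close> contribute the
  same, and there are \<open>(i + j) choose i\<close> of them. The induction moves the first letter of the
  shuffle into \<open>B\<close>, which is why \<open>B\<close> is arbitrary.
\<close>

lemma deconcat_sum_shuffle:
  assumes "\<And>x. qlinear (B x)"
    and "\<And>x b y. B (x @ b # y) = B (b # x @ y)"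
  shows "lin_ext (deconcat_sum B) (shuffle_words u v) =
    (\<Sum>i\<le>length u. \<Sum>j\<le>length v. qscale (of_nat ((i + j) choose i))
      (B (take i u @ take j v) (shuffle_words (drop i u) (drop j v))))"
  using assms
proof (induction u v arbitrary: B rule: shuffle_words.induct)
  case (1 w)
  then show ?case
    by (simp add: deconcat_sum_def qscale_one)
next
  case (2 a u)
  then show ?case
    by (simp add: deconcat_sum_def qscale_one shuffle_words_Nil2 del: sum.atMost_Suc)
next
  case (3 a u b v)
  have sym: "B (c # x @ d # y) = B (c # d # x @ y)" for c d x y
    using 3(4)[of "c # x" d y] 3(4)[of "[c]" d "x @ y"] by simp
  have "lin_ext (deconcat_sum B) (shuffle_words (a # u) (b # v))
      = B [] (shuffle_words (a # u) (b # v))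
        + lin_ext (deconcat_sum (\<lambda>x. B (a # x))) (shuffle_words u (b # v))
        + lin_ext (deconcat_sum (\<lambda>x. B (b # x))) (shuffle_words (a # u) v)"
    by (simp add: qlinear_simps[OF qlinear_lin_ext] qlinear_simps[OF 3(3)]
        deconcat_sum_prepend[OF 3(3)] algebra_simps)
  also have "lin_ext (deconcat_sum (\<lambda>x. B (a # x))) (shuffle_words u (b # v)) =
     (\<Sum>i\<le>length u. \<Sum>j\<le>Suc (length v). qscale (of_nat ((i + j) choose i))
       (B (take (Suc i) (a # u) @ take j (b # v))
          (shuffle_words (drop (Suc i) (a # u)) (drop j (b # v)))))"
    by (subst 3(1)) (simp_all add: 3(3) sym)
  also have "lin_ext (deconcat_sum (\<lambda>x. B (b # x))) (shuffle_words (a # u) v) =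
     (\<Sum>i\<le>Suc (length u). \<Sum>j\<le>length v. qscale (of_nat ((i + j) choose i))
       (B (take i (a # u) @ take (Suc j) (b # v))
          (shuffle_words (drop i (a # u)) (drop (Suc j) (b # v)))))"
    by (subst 3(2)) (simp_all add: 3(3,4) sym del: sum.atMost_Suc)
  finally show ?case
    using pascal_double_sum[where m = "length u" and n = "length v"
      and T = "\<lambda>i j. B (take i (a # u) @ take j (b # v))
          (shuffle_words (drop i (a # u)) (drop j (b # v)))"]
    by (simp del: sum.atMost_Suc shuffle_words.simps)
qed

section \<open>The map as a sum over prefixes\<close>

lemma bracket_Cons:
  "w \<noteq> [] \<Longrightarrow> bracket dia (a # w) = dia (basis_vec a) (bracket dia w)"
  by (cases w) auto

lemma bracket_append:
  assumes "\<And>x y z. dia (dia x y) z = dia x (dia y z)"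
    and "u \<noteq> []" "v \<noteq> []"
  shows "bracket dia (u @ v) = dia (bracket dia u) (bracket dia v)"
  using assms(2,3)
proof (induction u)
  case (Cons a u)
  then show ?case
    by (cases "u = []") (auto simp: bracket_Cons assms(1))
qed simp

lemma bracket_move_to_front:
  assumes "\<And>x y. dia x y = dia y x"
    and "\<And>x y z. dia (dia x y) z = dia x (dia y z)"
  shows "bracket dia (x @ b # y) = bracket dia (b # x @ y)"
proof (cases "x = []")
  case False
  have "bracket dia (x @ [b]) = bracket dia (b # x)"
    using False bracket_append[OF assms(2), of x "[b]"] assms(1)
    by (simp add: bracket_Cons)
  then show ?thesis
    using False bracket_append[OF assms(2), of "x @ [b]" y] bracket_append[OF assms(2), of "b # x" y]
    by (cases "y = []") auto
qed simp

lemma bracket_perm: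
  assumes "\<And>x y. dia x y = dia y x"
    and "\<And>x y z. dia (dia x y) z = dia x (dia y z)"
    and "mset x = mset y"
  shows "bracket dia x = bracket dia y"
  using assms(3)
proof (induction x arbitrary: y)
  case (Cons a x)
  then obtain y1 y2 where y: "y = y1 @ a # y2"
    by (metis list.set_intros(1) mset_eq_setD split_list)
  with Cons.prems have "mset x = mset (y1 @ y2)"
    by simp
  then have "bracket dia x = bracket dia (y1 @ y2)" "x = [] \<longleftrightarrow> y1 @ y2 = []"
    using Cons.IH by (auto dest: mset_eq_length)
  then have "bracket dia (a # x) = bracket dia (a # y1 @ y2)"
    by (cases "x = []") (auto simp: bracket_Cons)
  then show ?case
    using y bracket_move_to_front[OF assms(1,2)] by metis
qed simp

lemma compositions_0: "compositions 0 = {[]}"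
proof -
  have "I = []" if "I \<in> compositions 0" for I
    using that by (cases I) (auto simp: compositions_def)
  then show ?thesis
    by (auto simp: compositions_def)
qed

lemma compositions_pos:
  assumes "0 < n"
  shows "compositions n = (\<lambda>(i, I). i # I) ` (SIGMA i:{1..n}. compositions (n - i))"
proof (intro set_eqI iffI)
  fix J assume "J \<in> compositions n"
  with assms show "J \<in> (\<lambda>(i, I). i # I) ` (SIGMA i:{1..n}. compositions (n - i))"
    by (cases J) (auto simp: compositions_def image_iff)
qed (auto simp: compositions_def)

lemma Psi_tanh_basis_vec:
  "Psi_tanh dia (basis_vec w) = (\<Sum>I\<in>compositions (length w).
     qscale (prod_list (map tanh_coeff I)) (comp_act dia I w))"
  by (simp add: Psi_tanh_def compositions_0 qscale_one)

lemma qlinear_Psi_tanh: "qlinear (Psi_tanh dia)"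
  by (simp add: Psi_tanh_def qlinear_lin_ext)

text \<open>
  What the compositions with first block \<open>x\<close> contribute to the image of a word \<open>x @ v\<close>, for
  \<open>P = basis_vec v\<close>.
\<close>

definition bracket_split ::
    "('z qvec \<Rightarrow> 'z qvec \<Rightarrow> 'z qvec) \<Rightarrow> 'z list \<Rightarrow> 'z ncpoly \<Rightarrow> 'z ncpoly" where
  "bracket_split dia x P =
     qscale (tanh_coeff (length x)) (lcons (bracket dia x) (Psi_tanh dia P))"

text \<open>
  Compositions of \<open>length w\<close> are sorted by their first part. The empty prefix, for which there is no
  composition, may be included since \<open>tanh_coeff 0 = 0\<close>.
\<close>

lemma Psi_tanh_nonempty:
  assumes "w \<noteq> []"
  shows "Psi_tanh dia (basis_vec w) = deconcat_sum (bracket_split dia) w"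
proof -
  let ?f = "\<lambda>I w. qscale (prod_list (map tanh_coeff I)) (comp_act dia I w)"
  let ?n = "length w"
  have "Psi_tanh dia (basis_vec w)
      = (\<Sum>(i, I)\<in>(SIGMA i:{1..?n}. compositions (?n - i)). ?f (i # I) w)"
    unfolding Psi_tanh_basis_vec using assms
    by (subst compositions_pos) (auto simp: sum.reindex inj_on_def case_prod_unfold)
  also have "\<dots> = (\<Sum>i=1..?n. \<Sum>I\<in>compositions (?n - i). ?f (i # I) w)"
    by (subst sum.Sigma) (auto simp: finite_compositions)
  also have "\<dots> = (\<Sum>i=1..?n. bracket_split dia (take i w) (basis_vec (drop i w)))"
    by (intro sum.cong refl)
      (simp add: bracket_split_def Psi_tanh_basis_vec qbilinear_sum[OF qbilinear_lcons]
        qbilinear_simps[OF qbilinear_lcons] qscale_sum_right qscale_simps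
        lcons_def[symmetric] min_absorb2)
  also have "\<dots> = deconcat_sum (bracket_split dia) w"
    unfolding deconcat_sum_def
    by (intro sum.mono_neutral_left) (auto simp: bracket_split_def qscale_zero_left not_less_eq_eq)
  finally show ?thesis .
qed

text \<open>
  The sum over prefixes is \<open>0\<close> on the empty word; the first summand corrects this.
\<close>

lemma Psi_tanh_eq_deconcat_sum:
  "Psi_tanh dia P = qscale (Poly_Mapping.lookup P []) (basis_vec [])
     + lin_ext (deconcat_sum (bracket_split dia)) P"
proof (induction P rule: qvec_induct)
  case (basis w)
  show ?case
  proof (cases "w = []")
    case True
    then show ?thesis
      by (simp add: Psi_tanh_basis_vec compositions_0 deconcat_sum_def bracket_split_def qscale_simps)
  next
    case False
    then show ?thesis
      by (simp add: Psi_tanh_nonempty qscale_zero_left lookup_single)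
  qed
qed (simp_all add: qlinear_simps[OF qlinear_Psi_tanh] qlinear_simps[OF qlinear_lin_ext]
    lookup_add qscale_add_left qscale_simps algebra_simps)

lemma lookup_prepend_Nil: "Poly_Mapping.lookup (prepend a P) [] = 0"
  by (induction P rule: qvec_induct)
    (simp_all add: prepend_eq_lcons qbilinear_simps[OF qbilinear_lcons] lcons_basis_vec
      lookup_add lookup_single)

lemma lookup_shuffle_words_Nil:
  "Poly_Mapping.lookup (shuffle_words u v) [] = (if u = [] \<and> v = [] then 1 else 0)"
  by (cases "(u, v)" rule: shuffle_words.cases) (auto simp: lookup_single lookup_add lookup_prepend_Nil)

lemma qlinear_bracket_split: "qlinear (bracket_split dia x)"
  by (rule qlinearI)
    (simp_all add: bracket_split_def qlinear_simps[OF qlinear_Psi_tanh]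
      qbilinear_simps[OF qbilinear_lcons] qscale_simps mult.commute)

text \<open>
  The brackets are invariant under permutations, so the deconcatenation formula for shuffles
  applies. The term \<open>i = j = 0\<close> with its meaningless empty bracket has coefficient \<open>tanh_coeff 0 = 0\<close>.
\<close>

lemma Psi_tanh_shuffle_expansion:
  assumes "\<And>x y. dia x y = dia y x"
    and "\<And>x y z. dia (dia x y) z = dia x (dia y z)"
  shows "Psi_tanh dia (shuffle_words u v) =
    qscale (if u = [] \<and> v = [] then 1 else 0) (basis_vec []) +
    (\<Sum>i\<le>length u. \<Sum>j\<le>length v. qscale (of_nat ((i + j) choose i) * tanh_coeff (i + j))
      (lcons (bracket dia (take i u @ take j v)) (Psi_tanh dia (shuffle_words (drop i u) (drop j v)))))"
proof -
  have sym: "bracket_split dia (x @ b # y) = bracket_split dia (b # x @ y)" for x b y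
    by (simp add: bracket_split_def fun_eq_iff bracket_move_to_front[OF assms])
  show ?thesis
    unfolding Psi_tanh_eq_deconcat_sum[of dia "shuffle_words u v"]
      deconcat_sum_shuffle[of "bracket_split dia", OF qlinear_bracket_split sym]
      lookup_shuffle_words_Nil
    by (intro arg_cong2[where f = "(+)"] refl sum.cong)
      (simp add: bracket_split_def qscale_simps min_def)
qed

section \<open>Multiplicativity\<close>

text \<open>
  Two successive prefixes, of lengths \<open>i\<close> and \<open>k\<close>, are described by the total length \<open>r = i + k\<close>
  and the position \<open>i\<close> of the inner cut.
\<close>

lemma sum_triangle_reindex:
  fixes f :: "nat \<Rightarrow> nat \<Rightarrow> 'a::comm_monoid_add"
  shows "(\<Sum>i\<le>m. \<Sum>k\<le>m - i. f i (i + k)) = (\<Sum>r\<le>m. \<Sum>i\<le>r. f i r)"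
  unfolding sum.Sigma[OF finite_atMost ballI[OF finite_atMost]]
  by (rule sum.reindex_bij_witness[where j = "\<lambda>(i, k). (i + k, i)"
      and i = "\<lambda>(r, i). (i, r - i)"]) auto

lemma sum_double_triangle_reindex:
  fixes f :: "nat \<Rightarrow> nat \<Rightarrow> nat \<Rightarrow> nat \<Rightarrow> 'a::comm_monoid_add"
  shows "(\<Sum>i\<le>m. \<Sum>j\<le>n. \<Sum>k\<le>m - i. \<Sum>l\<le>n - j. f i j (i + k) (j + l))
    = (\<Sum>r\<le>m. \<Sum>s\<le>n. \<Sum>i\<le>r. \<Sum>j\<le>s. f i j r s)"
proof -
  have "(\<Sum>i\<le>m. \<Sum>j\<le>n. \<Sum>k\<le>m - i. \<Sum>l\<le>n - j. f i j (i + k) (j + l))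
      = (\<Sum>i\<le>m. \<Sum>k\<le>m - i. \<Sum>j\<le>n. \<Sum>l\<le>n - j. f i j (i + k) (j + l))"
    by (intro sum.cong refl sum.swap)
  also have "\<dots> = (\<Sum>i\<le>m. \<Sum>k\<le>m - i. \<Sum>s\<le>n. \<Sum>j\<le>s. f i j (i + k) s)"
    by (intro sum.cong refl sum_triangle_reindex)
  also have "\<dots> = (\<Sum>r\<le>m. \<Sum>i\<le>r. \<Sum>s\<le>n. \<Sum>j\<le>s. f i j r s)"
    by (rule sum_triangle_reindex)
  also have "\<dots> = (\<Sum>r\<le>m. \<Sum>s\<le>n. \<Sum>i\<le>r. \<Sum>j\<le>s. f i j r s)"
    by (intro sum.cong refl sum.swap)
  finally show ?thesis .
qed

text \<open>
  Both sides are written as combinations of the vectors \<open>T r s\<close>, the bracket of the first \<open>r\<close> letters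
  of \<open>u\<close> and \<open>s\<close> letters of \<open>v\<close> followed by the image of the shuffle of the rests. The coefficients
  are the two sides of the addition formula.
\<close>

lemma Psi_tanh_shuffle_words:
  assumes "qbilinear dia"
    and comm: "\<And>x y. dia x y = dia y x"
    and assoc: "\<And>x y z. dia (dia x y) z = dia x (dia y z)"
  shows "Psi_tanh dia (shuffle_words u v) =
    star_prod dia (Psi_tanh dia (basis_vec u)) (Psi_tanh dia (basis_vec v))"
proof (induction "length u + length v" arbitrary: u v rule: less_induct)
  case less
  show ?case
  proof (cases "u = [] \<or> v = []")
    case True
    have "Psi_tanh dia (basis_vec []) = basis_vec []"
      by (simp add: Psi_tanh_basis_vec compositions_0 qscale_one)
    with True show ?thesis
      by (auto simp: shuffle_words_Nil2)
  next
    case False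
    let ?m = "length u" and ?n = "length v" and ?c = tanh_coeff
    define P where "P i = Psi_tanh dia (basis_vec (drop i u))" for i
    define Q where "Q j = Psi_tanh dia (basis_vec (drop j v))" for j
    define X where "X i j = Psi_tanh dia (shuffle_words (drop i u) (drop j v))" for i j
    define a where "a i = bracket dia (take i u)" for i
    define b where "b j = bracket dia (take j v)" for j
    define e where "e i j = bracket dia (take i u @ take j v)" for i j
    define T where "T i j = lcons (e i j) (X i j)" for i j
    note lc = qbilinear_simps[OF qbilinear_lcons] qbilinear_sum[OF qbilinear_lcons]
    note st = qbilinear_simps[OF qbilinear_star_prod] qbilinear_sum[OF qbilinear_star_prod]
    note L = qlinear_simps[OF qlinear_L_map] qlinear_sum[OF qlinear_L_map]
    \<comment> \<open>The induction hypothesis, available as soon as one of the two words becomes shorter.\<close>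
    have IH: "X i j = star_prod dia (P i) (Q j)"
      if "i \<le> ?m" "j \<le> ?n" "0 < i \<or> 0 < j" for i j
      unfolding X_def P_def Q_def using that False by (intro less) auto
    have P0: "P 0 = (\<Sum>i\<le>?m. qscale (?c i) (lcons (a i) (P i)))"
      using False by (simp add: P_def a_def Psi_tanh_nonempty deconcat_sum_def bracket_split_def
          min_absorb2 cong: sum.cong_simp)
    have Q0: "Q 0 = (\<Sum>j\<le>?n. qscale (?c j) (lcons (b j) (Q j)))"
      using False by (simp add: Q_def b_def Psi_tanh_nonempty deconcat_sum_def bracket_split_def
          min_absorb2 cong: sum.cong_simp)
    have X: "X i j = qscale (if drop i u = [] \<and> drop j v = [] then 1 else 0) (basis_vec []) +
       (\<Sum>k\<le>?m - i. \<Sum>l\<le>?n - j. qscale (tanh_add_coeff k l)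
         (lcons (bracket dia (take k (drop i u) @ take l (drop j v))) (X (i + k) (j + l))))" for i j
      unfolding X_def Psi_tanh_shuffle_expansion[OF comm assoc, of "drop i u"]
      by (simp add: tanh_add_coeff_def add.commute)
    \<comment> \<open>For \<open>k = l = 0\<close> the inner bracket is empty, but then the coefficient is \<open>0\<close>; likewise for \<open>i = 0\<close> or \<open>j = 0\<close>.\<close>
    have L_X: "qscale (?c i * ?c j) (L_map dia (dia (a i) (b j)) (X i j)) =
        (\<Sum>k\<le>?m - i. \<Sum>l\<le>?n - j.
          qscale (?c i * ?c j * tanh_add_coeff k l) (T (i + k) (j + l)))"
      if ij: "i \<le> ?m" "j \<le> ?n" for i j
    proof (cases "i = 0 \<or> j = 0")
      case True
      then show ?thesis
        by (auto simp: qscale_zero_left)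
    next
      case ij0: False
      have term_eq: "qscale (tanh_add_coeff k l)
          (lcons (dia (dia (a i) (b j)) (bracket dia (take k (drop i u) @ take l (drop j v))))
            (X (i + k) (j + l))) = qscale (tanh_add_coeff k l) (T (i + k) (j + l))"
        if kl: "k \<le> ?m - i" "l \<le> ?n - j" for k l
      proof (cases "k = 0 \<and> l = 0")
        case True
        then show ?thesis
          by (simp add: tanh_add_coeff_def qscale_zero_left)
      next
        case kl0: False
        have "take i u \<noteq> []" "take j v \<noteq> []"
          using ij0 False by auto
        moreover have ne: "take k (drop i u) @ take l (drop j v) \<noteq> []"
          using ij kl kl0 by auto
        ultimately have "dia (dia (a i) (b j)) (bracket dia (take k (drop i u) @ take l (drop j v)))
            = bracket dia ((take i u @ take j v) @ (take k (drop i u) @ take l (drop j v)))"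
          unfolding a_def b_def by (simp add: bracket_append[OF assoc] del: append_assoc)
        also have "\<dots> = e (i + k) (j + l)"
          unfolding e_def take_add
          by (rule bracket_perm[OF comm assoc]) simp
        finally show ?thesis
          by (simp add: T_def)
      qed
      have "L_map dia (dia (a i) (b j)) (X i j) = (\<Sum>k\<le>?m - i. \<Sum>l\<le>?n - j.
          qscale (tanh_add_coeff k l)
          (lcons (dia (dia (a i) (b j)) (bracket dia (take k (drop i u) @ take l (drop j v))))
            (X (i + k) (j + l))))"
        by (subst X) (simp add: L L_map_lcons[OF assms(1)] qscale_zero_right)
      also have "\<dots> = (\<Sum>k\<le>?m - i. \<Sum>l\<le>?n - j. qscale (tanh_add_coeff k l) (T (i + k) (j + l)))"
        by (intro sum.cong refl term_eq) auto
      finally show ?thesis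
        by (simp add: qscale_sum_right qscale_simps)
    qed
    \<comment> \<open>The hypothesis gives nothing for \<open>i = j = 0\<close>; there the factor \<open>?c 0 = 0\<close> makes both sides vanish.\<close>
    have product: "star_prod dia (qscale (?c i) (lcons (a i) (P i))) (qscale (?c j) (lcons (b j) (Q j)))
      = qscale (?c i) (lcons (a i) (star_prod dia (P i) (qscale (?c j) (lcons (b j) (Q j)))))
       + qscale (?c j) (lcons (b j) (star_prod dia (qscale (?c i) (lcons (a i) (P i))) (Q j)))
       - qscale (?c i * ?c j) (L_map dia (dia (a i) (b j)) (X i j))"
      if "i \<le> ?m" "j \<le> ?n" for i j
    proof (cases "i = 0")
      case True
      then show ?thesis
        by (simp add: qscale_simps st lc)
    next
      case False
      with that show ?thesis
        by (simp add: IH star_prod_lcons[OF assms(1)] st lc qscale_simps mult.commute)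
    qed
    have "star_prod dia (P 0) (Q 0) = (\<Sum>i\<le>?m. \<Sum>j\<le>?n.
        star_prod dia (qscale (?c i) (lcons (a i) (P i))) (qscale (?c j) (lcons (b j) (Q j))))"
      unfolding P0 qbilinear_sum(1)[OF qbilinear_star_prod]
      unfolding Q0 qbilinear_sum(2)[OF qbilinear_star_prod] ..
    also have "\<dots>
      = (\<Sum>i\<le>?m. \<Sum>j\<le>?n. qscale (?c i)
          (lcons (a i) (star_prod dia (P i) (qscale (?c j) (lcons (b j) (Q j))))))
       + (\<Sum>i\<le>?m. \<Sum>j\<le>?n. qscale (?c j)
          (lcons (b j) (star_prod dia (qscale (?c i) (lcons (a i) (P i))) (Q j))))
       - (\<Sum>i\<le>?m. \<Sum>j\<le>?n. qscale (?c i * ?c j) (L_map dia (dia (a i) (b j)) (X i j)))"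
      unfolding sum.distrib[symmetric] sum_subtractf[symmetric]
      by (intro sum.cong refl product) auto
    also have "(\<Sum>i\<le>?m. \<Sum>j\<le>?n. qscale (?c i)
          (lcons (a i) (star_prod dia (P i) (qscale (?c j) (lcons (b j) (Q j))))))
        = (\<Sum>i\<le>?m. qscale (?c i) (lcons (a i) (star_prod dia (P i) (Q 0))))"
      by (simp only: Q0 st lc qscale_sum_right)
    also have "\<dots> = (\<Sum>i\<le>?m. qscale (?c i) (T i 0))"
    proof (rule sum.cong[OF refl])
      fix i assume "i \<in> {..?m}"
      then show "qscale (?c i) (lcons (a i) (star_prod dia (P i) (Q 0))) = qscale (?c i) (T i 0)"
        by (cases "i = 0") (simp_all add: qscale_zero_left T_def IH e_def a_def)
    qed
    also have "(\<Sum>i\<le>?m. \<Sum>j\<le>?n. qscale (?c j)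
          (lcons (b j) (star_prod dia (qscale (?c i) (lcons (a i) (P i))) (Q j))))
        = (\<Sum>j\<le>?n. qscale (?c j) (lcons (b j) (star_prod dia (P 0) (Q j))))"
      by (subst sum.swap) (simp only: P0 st lc qscale_sum_right)
    also have "\<dots> = (\<Sum>j\<le>?n. qscale (?c j) (T 0 j))"
    proof (rule sum.cong[OF refl])
      fix j assume "j \<in> {..?n}"
      then show "qscale (?c j) (lcons (b j) (star_prod dia (P 0) (Q j))) = qscale (?c j) (T 0 j)"
        by (cases "j = 0") (simp_all add: qscale_zero_left T_def IH e_def b_def)
    qed
    also have "(\<Sum>i\<le>?m. \<Sum>j\<le>?n. qscale (?c i * ?c j) (L_map dia (dia (a i) (b j)) (X i j)))
        = (\<Sum>i\<le>?m. \<Sum>j\<le>?n. \<Sum>k\<le>?m - i. \<Sum>l\<le>?n - j.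
            qscale (?c i * ?c j * tanh_add_coeff (i + k - i) (j + l - j)) (T (i + k) (j + l)))"
      by (intro sum.cong refl) (simp add: L_X)
    also have "\<dots> = (\<Sum>r\<le>?m. \<Sum>s\<le>?n. qscale
        (\<Sum>i\<le>r. \<Sum>j\<le>s. ?c i * ?c j * tanh_add_coeff (r - i) (s - j)) (T r s))"
      by (subst sum_double_triangle_reindex) (simp add: qscale_sum_left)
    also have "(\<Sum>i\<le>?m. qscale (?c i) (T i 0)) =
        (\<Sum>r\<le>?m. \<Sum>s\<le>?n. qscale (if s = 0 then ?c r else 0) (T r s))"
      by (simp add: if_distrib[of "\<lambda>x. qscale x _"] qscale_zero_left sum.delta cong: if_cong)
    also have "(\<Sum>j\<le>?n. qscale (?c j) (T 0 j)) =
        (\<Sum>r\<le>?m. \<Sum>s\<le>?n. qscale (if r = 0 then ?c s else 0) (T r s))"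
      by (subst sum.swap)
        (simp add: if_distrib[of "\<lambda>x. qscale x _"] qscale_zero_left sum.delta cong: if_cong)
    \<comment> \<open>All three sums now run over the same \<open>T r s\<close>, and the addition formula collects them.\<close>
    also have "(\<Sum>r\<le>?m. \<Sum>s\<le>?n. qscale (if s = 0 then ?c r else 0) (T r s)) +
        (\<Sum>r\<le>?m. \<Sum>s\<le>?n. qscale (if r = 0 then ?c s else 0) (T r s)) -
        (\<Sum>r\<le>?m. \<Sum>s\<le>?n. qscale
          (\<Sum>i\<le>r. \<Sum>j\<le>s. ?c i * ?c j * tanh_add_coeff (r - i) (s - j)) (T r s))
      = (\<Sum>r\<le>?m. \<Sum>s\<le>?n. qscale (tanh_add_coeff r s) (T r s))"
      unfolding sum.distrib[symmetric] sum_subtractf[symmetric]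
        qscale_add_left[symmetric] qscale_diff_left[symmetric]
      by (intro sum.cong refl arg_cong2[where f = qscale] tanh_add_coeff[symmetric])
    also have "\<dots> = X 0 0"
      using False by (simp add: X[of 0 0] qscale_zero_left T_def e_def)
    finally show ?thesis
      by (simp add: X_def P_def Q_def)
  qed
qed

lemma Psi_tanh_shuffle_prod:
  assumes "qbilinear dia"
    and "\<And>x y. dia x y = dia y x"
    and "\<And>x y z. dia (dia x y) z = dia x (dia y z)"
  shows "Psi_tanh dia (shuffle_prod P Q) = star_prod dia (Psi_tanh dia P) (Psi_tanh dia Q)"
proof -
  have bil: "qbilinear shuffle_prod"
    by (simp add: shuffle_prod_def qbilinear_bilin_ext)
  note lin = qbilinear_simps[OF bil] qbilinear_simps[OF qbilinear_star_prod]
    qlinear_simps[OF qlinear_Psi_tanh]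
  show ?thesis
  proof (induction P rule: qvec_induct)
    case (basis u)
    show ?case
      by (induction Q rule: qvec_induct)
        (simp_all add: lin, simp add: shuffle_prod_def bilin_ext_basis_vec
          Psi_tanh_shuffle_words[OF assms])
  qed (simp_all add: lin)
qed

section \<open>Bijectivity\<close>

text \<open>
  A linear map that changes each basis vector only by basis vectors of smaller degree is bijective.
  Injectivity: a basis vector of maximal degree in \<open>r\<close> keeps its coefficient in \<open>f r\<close>. Surjectivity:
  by induction on the degree, \<open>x\<close> is \<open>f x\<close> minus an element of the range.
\<close>

lemma bij_of_unitriangular:
  fixes f :: "'a qvec \<Rightarrow> 'a qvec" and d :: "'a \<Rightarrow> nat"
  assumes lin: "qlinear f"
    and tri: "\<And>x y. y \<in> Poly_Mapping.keys (f (basis_vec x) - basis_vec x) \<Longrightarrow> d y < d x"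
  shows "bij f"
proof (rule bijI)
  show "inj f"
  proof (rule injI, rule ccontr)
    fix p q assume "f p = f q" and "p \<noteq> q"
    define r where "r = p - q"
    have fr: "f r = 0" and "r \<noteq> 0"
      using \<open>f p = f q\<close> \<open>p \<noteq> q\<close> by (auto simp: r_def qlinear_diff[OF lin])
    let ?K = "Poly_Mapping.keys r"
    have K: "finite ?K" "?K \<noteq> {}"
      using \<open>r \<noteq> 0\<close> by auto
    then have "Max (d ` ?K) \<in> d ` ?K"
      by (intro Max_in) auto
    then obtain x where x: "x \<in> ?K" and "Max (d ` ?K) = d x"
      by (rule imageE)
    then have max: "d y \<le> d x" if "y \<in> ?K" for y
      using that by (metis Max_ge finite_imageI finite_keys imageI)
    have coeff: "Poly_Mapping.lookup (f (basis_vec y)) x = (if y = x then 1 else 0)"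
      if "y \<in> ?K" for y
    proof -
      have "x \<notin> Poly_Mapping.keys (f (basis_vec y) - basis_vec y)"
        using tri[of x y] max[OF that] by auto
      then show ?thesis
        by (simp add: in_keys_iff lookup_minus lookup_single when_def split: if_splits)
    qed
    have "f r = f (\<Sum>y\<in>?K. qscale (Poly_Mapping.lookup r y) (basis_vec y))"
      using lin_ext_basis_vec_eq[of r] by (simp add: lin_ext_def)
    also have "\<dots> = (\<Sum>y\<in>?K. qscale (Poly_Mapping.lookup r y) (f (basis_vec y)))"
      by (simp add: qlinear_sum[OF lin] qlinear_scale[OF lin])
    finally have "Poly_Mapping.lookup (f r) x = Poly_Mapping.lookup r x"
      using x by (simp add: lookup_sum coeff if_distrib sum.delta cong: if_cong)
    with fr x show False
      by (simp add: in_keys_iff)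
  qed
  have range_add: "p + q \<in> range f" if "p \<in> range f" "q \<in> range f" for p q
    using that by (auto simp: qlinear_add[OF lin, symmetric])
  have range_scale: "qscale c p \<in> range f" if "p \<in> range f" for c p
    using that by (auto simp: qlinear_scale[OF lin, symmetric])
  have range_zero: "0 \<in> range f"
    using rangeI[of f 0] by (simp add: qlinear_zero[OF lin])
  have basis: "basis_vec x \<in> range f" for x
  proof (induction "d x" arbitrary: x rule: less_induct)
    case less
    let ?r = "f (basis_vec x) - basis_vec x"
    have "(\<Sum>y\<in>A. qscale (Poly_Mapping.lookup ?r y) (basis_vec y)) \<in> range f"
      if "finite A" "A \<subseteq> Poly_Mapping.keys ?r" for A
      using that
    proof (induction A)
      case empty
      show ?case
        using range_zero by simp
    next
      case (insert y A)
      then have "y \<in> Poly_Mapping.keys ?r" and "A \<subseteq> Poly_Mapping.keys ?r"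
        by blast+
      then show ?case
        unfolding sum.insert[OF insert.hyps]
        by (intro range_add range_scale less tri insert.IH)
    qed
    from this[OF finite_keys order_refl] have "?r \<in> range f"
      by (simp only: lin_ext_def[symmetric] lin_ext_basis_vec_eq)
    then have "f (basis_vec x) + qscale (- 1) ?r \<in> range f"
      by (intro range_add range_scale) auto
    also have "f (basis_vec x) + qscale (- 1) ?r = basis_vec x"
      by (rule poly_mapping_eqI) (simp add: lookup_add lookup_minus)
    finally show ?case .
  qed
  have "p \<in> range f" for p
    by (induction p rule: qvec_induct) (simp_all add: basis range_zero range_add range_scale)
  then show "surj f"
    by auto
qed

lemma keys_lcons_length:
  assumes "w \<in> Poly_Mapping.keys (lcons c P)"
  shows "\<exists>v\<in>Poly_Mapping.keys P. length w = Suc (length v)"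
proof -
  have "lcons c P = (\<Sum>v\<in>Poly_Mapping.keys P. \<Sum>a\<in>Poly_Mapping.keys c.
      qscale (Poly_Mapping.lookup c a * Poly_Mapping.lookup P v) (basis_vec (a # v)))"
  proof -
    have "lcons c P = lcons (lin_ext basis_vec c) (lin_ext basis_vec P)"
      by (simp add: lin_ext_basis_vec_eq)
    then show ?thesis
      by (simp add: lin_ext_def qbilinear_sum[OF qbilinear_lcons] qbilinear_simps[OF qbilinear_lcons]
          lcons_basis_vec qscale_sum_right qscale_simps mult.commute)
  qed
  with assms have "(\<Sum>v\<in>Poly_Mapping.keys P. \<Sum>a\<in>Poly_Mapping.keys c.
      Poly_Mapping.lookup c a * Poly_Mapping.lookup P v *
        Poly_Mapping.lookup (basis_vec (a # v)) w) \<noteq> 0"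
    by (simp add: in_keys_iff lookup_sum)
  then obtain a v where "v \<in> Poly_Mapping.keys P"
    "Poly_Mapping.lookup (basis_vec (a # v) :: 'a ncpoly) w \<noteq> 0"
    by (metis (no_types, lifting) mult_zero_right sum.neutral)
  then show ?thesis
    by (auto simp: lookup_single when_def split: if_splits)
qed

lemma deconcat_sum_keys_subset:
  "Poly_Mapping.keys (deconcat_sum B w)
    \<subseteq> (\<Union>i\<le>length w. Poly_Mapping.keys (B (take i w) (basis_vec (drop i w))))"
  unfolding deconcat_sum_def by (rule keys_sum)

lemma keys_bracket_split_length:
  assumes "v \<in> Poly_Mapping.keys (bracket_split dia x P)"
  obtains u where "u \<in> Poly_Mapping.keys (Psi_tanh dia P)" "length v = Suc (length u)"
proof -
  have "v \<in> Poly_Mapping.keys (lcons (bracket dia x) (Psi_tanh dia P))"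
    using assms by (auto simp: bracket_split_def in_keys_iff)
  with that show thesis
    by (auto dest: keys_lcons_length)
qed

lemma Psi_tanh_length_le:
  "v \<in> Poly_Mapping.keys (Psi_tanh dia (basis_vec w)) \<Longrightarrow> length v \<le> length w"
proof (induction w arbitrary: v rule: length_induct)
  case (1 w)
  show ?case
  proof (cases "w = []")
    case True
    with 1(2) show ?thesis
      by (simp add: Psi_tanh_basis_vec compositions_0 qscale_one)
  next
    case False
    then have "v \<in> Poly_Mapping.keys (deconcat_sum (bracket_split dia) w)"
      using 1(2) by (simp add: Psi_tanh_nonempty)
    then obtain i where "i \<le> length w"
      and i: "v \<in> Poly_Mapping.keys (bracket_split dia (take i w) (basis_vec (drop i w)))"
      using deconcat_sum_keys_subset[of "bracket_split dia" w] by blast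
    then have "i \<noteq> 0"
      by (intro notI) (simp add: bracket_split_def qscale_zero_left)
    from i obtain u where "u \<in> Poly_Mapping.keys (Psi_tanh dia (basis_vec (drop i w)))"
      and "length v = Suc (length u)"
      by (rule keys_bracket_split_length)
    then have "length u \<le> length w - i"
      using 1(1) \<open>i \<noteq> 0\<close> False by (metis diff_less length_drop length_greater_0_conv neq0_conv)
    with \<open>length v = Suc (length u)\<close> \<open>i \<noteq> 0\<close> \<open>i \<le> length w\<close> show ?thesis
      by linarith
  qed
qed

text \<open>
  In the sum over prefixes of \<open>a # w\<close>, the prefix \<open>[a]\<close> has coefficient \<open>c\<^sub>1 = 1\<close> and is handled by
  induction; a longer prefix loses at least one letter when it is merged into its bracket.
\<close>

lemma Psi_tanh_unitriangular:
  "v \<in> Poly_Mapping.keys (Psi_tanh dia (basis_vec w) - basis_vec w) \<Longrightarrow> length v < length w"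
proof (induction w arbitrary: v)
  case Nil
  then show ?case
    by (simp add: Psi_tanh_basis_vec compositions_0 qscale_one)
next
  case (Cons a w)
  note lc = qbilinear_simps[OF qbilinear_lcons]
  let ?lower = "\<Sum>i\<in>{1..length w}. bracket_split dia (a # take i w) (basis_vec (drop i w))"
  have "{..length w} = insert 0 {1..length w}"
    by auto
  then have "deconcat_sum (\<lambda>x. bracket_split dia (a # x)) w
      = bracket_split dia [a] (basis_vec w) + ?lower"
    unfolding deconcat_sum_def by simp
  then have "Psi_tanh dia (basis_vec (a # w))
      = lcons (basis_vec a) (Psi_tanh dia (basis_vec w)) + ?lower"
    by (simp add: Psi_tanh_nonempty[of "a # w"] deconcat_sum_Cons)
      (simp add: bracket_split_def tanh_coeff_1 qscale_simps)
  then have "Psi_tanh dia (basis_vec (a # w)) - basis_vec (a # w)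
      = lcons (basis_vec a) (Psi_tanh dia (basis_vec w) - basis_vec w) + ?lower"
    by (simp add: lc lcons_basis_vec)
  then consider
      "v \<in> Poly_Mapping.keys (lcons (basis_vec a) (Psi_tanh dia (basis_vec w) - basis_vec w))"
    | "v \<in> Poly_Mapping.keys ?lower"
    using Cons.prems
      Poly_Mapping.keys_add[of "lcons (basis_vec a) (Psi_tanh dia (basis_vec w) - basis_vec w)" ?lower]
    by auto
  then show ?case
  proof cases
    case 1
    then show ?thesis
      using Cons.IH by (auto dest!: keys_lcons_length)
  next
    case 2
    then obtain i where "i \<in> {1..length w}"
      and "v \<in> Poly_Mapping.keys (bracket_split dia (a # take i w) (basis_vec (drop i w)))"
      using keys_sum[of "\<lambda>i. bracket_split dia (a # take i w) (basis_vec (drop i w))"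
        "{1..length w}"]
      by blast
    then obtain u where "u \<in> Poly_Mapping.keys (Psi_tanh dia (basis_vec (drop i w)))"
      and "length v = Suc (length u)"
      by (elim keys_bracket_split_length)
    with \<open>i \<in> _\<close> show ?thesis
      using Psi_tanh_length_le[of u dia "drop i w"] by auto
  qed
qed

section \<open>The isomorphism\<close>

theorem proposition3p3:
  fixes dia :: "('z::countable) qvec \<Rightarrow> 'z qvec \<Rightarrow> 'z qvec"
  assumes "qbilinear dia"
    and "\<And>x y. dia x y = dia y x"
    and "\<And>x y z. dia (dia x y) z = dia x (dia y z)"
  shows "algebra_iso shuffle_prod (basis_vec []) (star_prod dia) (basis_vec []) (Psi_tanh dia)"
  unfolding algebra_iso_def
proof (intro conjI allI)
  show "qlinear (Psi_tanh dia)"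
    by (rule qlinear_Psi_tanh)
  show "bij (Psi_tanh dia)"
    by (rule bij_of_unitriangular[where d = length, OF qlinear_Psi_tanh Psi_tanh_unitriangular])
  show "Psi_tanh dia (basis_vec []) = basis_vec []"
    by (simp add: Psi_tanh_basis_vec compositions_0 qscale_one)
  show "Psi_tanh dia (shuffle_prod P Q) = star_prod dia (Psi_tanh dia P) (Psi_tanh dia Q)" for P Q
    by (rule Psi_tanh_shuffle_prod[OF assms])
qed

end
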